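(* Let $r\ge 1$ be an integer and let $G$ be a finite simple connected graph with $m$ edges, where $m \geq (9r)^2$. Suppose that $G$ is $B_{r+1}$-free. Then $$\rho(G) \leq \sqrt{m},$$ with equality if and only if $G$ is a complete bipartite graph.
   Context: All graphs are finite, simple and connected, and have no isolated vertices. For a graph $G$, $\rho(G)$ denotes its spectral radius, i.e. the largest eigenvalue of its adjacency matrix. For an integer $k\ge 1$, the book of size $k$, denoted $B_k$, is the graph formed by $k$ triangles sharing a common edge (so $B_k$ has $k+2$ vertices and $2k+1$ edges). A graph is $B_k$-free if it does not contain $B_k$ as a (not necessarily induced) subgraph. *)

theory Defs
  imports "Graph_Theory.Graph_Theory" "Jordan_Normal_Form.Spectral_Radius"
begin

text \<open>
  A finite simple graph is a \<^locale>\<open>pair_graph\<close>: a finite symmetric loop-free digraph whose arcs are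
  ordered pairs of vertices. Each undirected edge thus occurs as two opposite arcs in \<^const>\<open>parcs\<close>,
  so the number of edges has to be counted on unordered pairs.
\<close>

definition edges :: "'a pair_pre_digraph \<Rightarrow> 'a set set" where
  "edges G = {{u, v} |u v. (u, v) \<in> parcs G}"

definition adjacency_matrix :: "'a list \<Rightarrow> 'a pair_pre_digraph \<Rightarrow> real mat" where
  "adjacency_matrix vs G =
    mat (length vs) (length vs) (\<lambda>(i, j). if (vs ! i, vs ! j) \<in> parcs G then 1 else 0)"

definition vertex_enum :: "'a pair_pre_digraph \<Rightarrow> 'a list" where
  "vertex_enum G = (SOME vs. distinct vs \<and> set vs = pverts G)"

text \<open>
  The enumeration of the vertices only permutes rows and columns of the adjacency matrix;
  \<open>graph_spectral_radius_eq\<close> below shows that the choice is immaterial. The matrix is real symmetric, so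
  the maximum over its real spectrum is its largest eigenvalue.
\<close>

definition graph_spectral_radius :: "'a pair_pre_digraph \<Rightarrow> real" where
  "graph_spectral_radius G = Max (spectrum (adjacency_matrix (vertex_enum G) G))"

definition book :: "nat \<Rightarrow> nat pair_pre_digraph" where
  "book k = \<lparr> pverts = {0..<k + 2},
    parcs = {(0, 1), (1, 0)} \<union> (\<Union>i\<in>{2..<k + 2}. {(0, i), (i, 0), (1, i), (i, 1)}) \<rparr>"

definition contains_copy :: "'a pair_pre_digraph \<Rightarrow> 'b pair_pre_digraph \<Rightarrow> bool" where
  "contains_copy G F \<longleftrightarrow> (\<exists>H. subgraph H (with_proj G) \<and> digraph_iso (with_proj F) H)"

definition book_free :: "nat \<Rightarrow> 'a pair_pre_digraph \<Rightarrow> bool" where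
  "book_free k G \<longleftrightarrow> \<not> contains_copy G (book k)"

definition complete_bipartite :: "'a pair_pre_digraph \<Rightarrow> bool" where
  "complete_bipartite G \<longleftrightarrow>
    (\<exists>s t. s \<ge> 1 \<and> t \<ge> 1 \<and> complete_bipartite_digraph s t (with_proj G))"

lemma eigenvalue_adjacency_matrix_iff:
  assumes vs: "distinct vs" "set vs = pverts G"
  shows "eigenvalue (adjacency_matrix vs G) k \<longleftrightarrow>
    (\<exists>f. (\<exists>v\<in>pverts G. f v \<noteq> 0) \<and>
      (\<forall>v\<in>pverts G. (\<Sum>w\<in>pverts G. (if (v, w) \<in> parcs G then 1 else 0) * f w) = k * f v))"
    (is "?L \<longleftrightarrow> (\<exists>f. ?P f)")
proof -
  define n where "n = length vs"
  let ?A = "adjacency_matrix vs G"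
  have A: "?A \<in> carrier_mat n n" by (simp add: adjacency_matrix_def n_def)
  have bij: "bij_betw ((!) vs) {0..<n} (pverts G)"
    using vs bij_betw_nth[of vs "{0..<n}" "pverts G"] by (simp add: n_def atLeast0LessThan)
  have ex: "(\<exists>v\<in>pverts G. Q v) \<longleftrightarrow> (\<exists>i<n. Q (vs ! i))"
    and all: "(\<forall>v\<in>pverts G. Q v) \<longleftrightarrow> (\<forall>i<n. Q (vs ! i))" for Q
    unfolding vs(2)[symmetric] n_def by (metis in_set_conv_nth)+
  have mv: "(?A *\<^sub>v x) $ i = (\<Sum>w\<in>pverts G. (if (vs ! i, w) \<in> parcs G then 1 else 0) * f w)"
    if i: "i < n" and x: "x \<in> carrier_vec n" "\<And>j. j < n \<Longrightarrow> x $ j = f (vs ! j)" for x f i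
  proof -
    have "(?A *\<^sub>v x) $ i = (\<Sum>j\<in>{0..<n}. (if (vs ! i, vs ! j) \<in> parcs G then 1 else 0) * f (vs ! j))"
      using i x by (auto simp: adjacency_matrix_def n_def scalar_prod_def intro!: sum.cong)
    also have "\<dots> = (\<Sum>w\<in>pverts G. (if (vs ! i, w) \<in> parcs G then 1 else 0) * f w)"
      by (rule sum.reindex_bij_betw[OF bij])
    finally show ?thesis .
  qed
  have key: "eigenvector ?A x k \<longleftrightarrow> ?P f"
    if x: "x \<in> carrier_vec n" "\<And>j. j < n \<Longrightarrow> x $ j = f (vs ! j)" for x f
  proof -
    have nz: "x \<noteq> 0\<^sub>v n \<longleftrightarrow> (\<exists>i<n. f (vs ! i) \<noteq> 0)"
      using x by (auto simp: vec_eq_iff)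
    have "?A *\<^sub>v x = k \<cdot>\<^sub>v x \<longleftrightarrow> (\<forall>i<n. (?A *\<^sub>v x) $ i = k * f (vs ! i))"
      using x carrier_matD(1)[OF A] by (auto simp: vec_eq_iff)
    also have "\<dots> \<longleftrightarrow>
      (\<forall>i<n. (\<Sum>w\<in>pverts G. (if (vs ! i, w) \<in> parcs G then 1 else 0) * f w) = k * f (vs ! i))"
      using mv[OF _ x] by (metis (no_types, lifting))
    finally show ?thesis
      unfolding eigenvector_def ex all carrier_matD(1)[OF A] using nz x(1) by (simp only: simp_thms)
  qed
  show ?thesis
  proof
    assume ?L
    then obtain x where x: "eigenvector ?A x k" by (auto simp: eigenvalue_def)
    then have xc: "x \<in> carrier_vec n" using A by (auto simp: eigenvector_def)
    have inj: "inj_on ((!) vs) {0..<n}" using bij by (simp add: bij_betw_def)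
    define f where "f = (\<lambda>v. x $ the_inv_into {0..<n} ((!) vs) v)"
    have "x $ j = f (vs ! j)" if "j < n" for j
      using that by (simp add: f_def the_inv_into_f_f[OF inj])
    from key[OF xc this] x have "?P f" by (rule iffD1)
    then show "\<exists>f. ?P f" by (rule exI[of _ f])
  next
    assume "\<exists>f. ?P f"
    then obtain f where f: "?P f" by (rule exE)
    have "vec n (\<lambda>i. f (vs ! i)) $ j = f (vs ! j)" if "j < n" for j
      using that by simp
    from key[OF vec_carrier this] f have "eigenvector ?A (vec n (\<lambda>i. f (vs ! i))) k"
      by (rule iffD2)
    then show ?L unfolding eigenvalue_def by (rule exI)
  qed
qed

lemma graph_spectral_radius_eq:
  assumes "distinct vs" "set vs = pverts G"
  shows "graph_spectral_radius G = Max (spectrum (adjacency_matrix vs G))"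
proof -
  have "\<exists>vs. distinct vs \<and> set vs = pverts G" using assms by blast
  then have enum: "distinct (vertex_enum G) \<and> set (vertex_enum G) = pverts G"
    unfolding vertex_enum_def by (rule someI_ex)
  have "eigenvalue (adjacency_matrix (vertex_enum G) G) k \<longleftrightarrow> eigenvalue (adjacency_matrix vs G) k"
    for k
    unfolding eigenvalue_adjacency_matrix_iff[OF enum[THEN conjunct1] enum[THEN conjunct2]]
      eigenvalue_adjacency_matrix_iff[OF assms] ..
  then show ?thesis
    unfolding graph_spectral_radius_def spectrum_def by presburger
qed

end

theory Submission
  imports "HOL-Analysis.Function_Topology" Defs
begin

text \<open>
  Let \<open>x\<close> be the Perron vector scaled so that its largest entry is \<open>x\<^sub>u = 1\<close>, let \<open>A\<close> be the
  neighbourhood of \<open>u\<close> and \<open>B\<close> its complement (so \<open>u \<in> B\<close>), and write \<open>d\<^sub>A\<close>, \<open>d\<^sub>B\<close> for the number of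
  neighbours in \<open>A\<close> and \<open>B\<close>. Counting walks of length two from \<open>u\<close> turns \<open>m \<le> \<rho>\<^sup>2\<close> into
  \<open>\<Sum>\<^sub>B d\<^sub>B + 2 \<Sum>\<^sub>B d\<^sub>A (1 - x) \<le> \<Sum>\<^sub>A d\<^sub>A (2 x - 1)\<close>, whose right-hand side is the sum \<open>R\<close> of
  \<open>x\<^sub>a + x\<^sub>b - 1\<close> over the arcs \<open>(a, b)\<close> inside \<open>A\<close>. If \<open>M\<^sub>a\<close> is the weight of the vertices of \<open>B\<close> not
  adjacent to \<open>a\<close>, the left-hand side dominates \<open>\<Sum>\<^sub>A x\<^sub>a M\<^sub>a\<close>. A vertex of \<open>A\<close> lies on at most \<open>r\<close>
  edges inside \<open>A\<close>. If \<open>a\<close>, \<open>b\<close> are the ends of such an edge and \<open>x\<^sub>a + x\<^sub>b \<ge> 1\<close>, then, as they have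
  few common neighbours, one of them, say \<open>b\<close>, satisfies \<open>M\<^sub>b > 2 r\<close>, so that
  \<open>x\<^sub>b M\<^sub>b > 2 r x\<^sub>b \<ge> 2 r (x\<^sub>a + x\<^sub>b - 1)\<close>. Hence one edge inside \<open>A\<close> would give \<open>\<Sum>\<^sub>A x\<^sub>a M\<^sub>a > R\<close>,
  a contradiction. So \<open>A\<close> is independent, \<open>R = 0\<close>, and all inequalities are tight, which forces the
  graph to be complete bipartite between \<open>A\<close> and \<open>B\<close>.
\<close>

section \<open>Variational eigenvectors of nonnegative symmetric matrices\<close>

lemma nonneg_quadratic_imp_linear_coeff_zero:
  fixes b c :: real
  assumes "\<And>t. 0 \<le> 2 * t * b + t\<^sup>2 * c"
  shows "b = 0"
proof (rule ccontr)
  assume "b \<noteq> 0"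
  \<comment> \<open>The positive bound \<open>d\<close> on \<open>c\<close> avoids a case split on
    the sign of \<open>c\<close>; the test point \<open>- b / d\<close> minimises the quadratic with
    \<open>d\<close> in place of \<open>c\<close>.\<close>
  define d where "d = \<bar>c\<bar> + 1"
  have d: "d > 0" "c \<le> d" by (auto simp: d_def)
  have "2 * (- b / d) * b + (- b / d)\<^sup>2 * c \<le> 2 * (- b / d) * b + (- b / d)\<^sup>2 * d"
    using d by (intro add_left_mono mult_left_mono) auto
  also have "\<dots> = - (b\<^sup>2 / d)"
    using d by (simp add: field_simps power2_eq_square)
  also have "\<dots> < 0" using d \<open>b \<noteq> 0\<close> by simp
  finally show False using assms[of "- b / d"] by simp
qed

text \<open>The quadratic form attains its maximum on the compact set of nonnegative unit vectors,
  and the first-order condition makes the maximiser an eigenvector. The last conclusion, valid for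
  every \<open>z\<close>, later bounds all other eigenvalues by \<open>\<mu>\<close>.\<close>

lemma nonneg_symmetric_maximal_eigenvector:
  fixes a :: "'a \<Rightarrow> 'a \<Rightarrow> real"
  assumes V: "finite V" "V \<noteq> {}"
    and sym: "\<And>v w. v \<in> V \<Longrightarrow> w \<in> V \<Longrightarrow> a v w = a w v"
    and nonneg: "\<And>v w. v \<in> V \<Longrightarrow> w \<in> V \<Longrightarrow> 0 \<le> a v w"
  obtains f \<mu> where "\<And>v. v \<in> V \<Longrightarrow> 0 \<le> f v" "\<exists>v\<in>V. f v \<noteq> 0"
    "\<And>v. v \<in> V \<Longrightarrow> (\<Sum>w\<in>V. a v w * f w) = \<mu> * f v"
    "\<And>z. (\<Sum>v\<in>V. \<Sum>w\<in>V. a v w * z v * z w) \<le> \<mu> * (\<Sum>v\<in>V. (z v)\<^sup>2)"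
proof -
  define q where "q = (\<lambda>z. \<Sum>v\<in>V. \<Sum>w\<in>V. a v w * z v * z w)"
  define n where "n = (\<lambda>z. \<Sum>v\<in>V. (z v :: real)\<^sup>2)"
  \<comment> \<open>Fixing the value 0 outside \<open>V\<close> places \<open>K\<close> inside a
    product of compact sets, so Tychonoff's theorem applies. Allowing only nonnegative vectors makes
    the maximiser nonnegative outright.\<close>
  define K where "K = {f. (\<forall>v. f v \<in> (if v \<in> V then {0..1} else {0::real})) \<and> n f = 1}"
  have "compact K"
  proof -
    let ?C = "PiE UNIV (\<lambda>v. if v \<in> V then {0..1} else {0::real})"
    have "compactin (product_topology (\<lambda>_. euclidean) UNIV) ?C"
      by (subst compactin_PiE) auto
    then have C: "compact ?C"
      by (simp add: euclidean_product_topology)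
    have "continuous_on UNIV n"
      unfolding n_def by (intro continuous_intros continuous_on_product_coordinates)
    then have "closed {f. n f = 1}"
      using closed_Collect_eq[of n "\<lambda>_. 1"] by simp
    then have "compact (?C \<inter> {f. n f = 1})" using C by blast
    moreover have "?C \<inter> {f. n f = 1} = K" by (auto simp: K_def PiE_def Pi_def)
    ultimately show ?thesis by simp
  qed
  moreover obtain v0 where v0: "v0 \<in> V" using V by blast
  have "n (\<lambda>v. if v = v0 then 1 else 0) = 1"
    using V v0 by (simp add: n_def if_distrib[of "\<lambda>x. x\<^sup>2"] cong: if_cong)
  then have "(\<lambda>v. if v = v0 then 1 else 0) \<in> K"
    using v0 by (auto simp: K_def)
  then have "K \<noteq> {}" by blast
  moreover have "continuous_on K q"
    unfolding q_def by (intro continuous_intros continuous_on_subset[OF continuous_on_product_coordinates]) auto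
  ultimately obtain f where f: "f \<in> K" "\<And>g. g \<in> K \<Longrightarrow> q g \<le> q f"
    by (metis continuous_attains_sup)
  define \<mu> where "\<mu> = q f"
  have f0: "0 \<le> f v" for v
  proof -
    have "f v \<in> (if v \<in> V then {0..1} else {0})" using f(1) by (auto simp: K_def)
    then show ?thesis by (auto split: if_splits)
  qed
  have nf: "n f = 1" using f(1) by (simp add: K_def)
  have bound: "q z \<le> \<mu> * n z" for z \<comment> \<open>replacing \<open>z\<close> by \<open>\<bar>z\<bar>\<close> does not decrease \<open>q\<close>\<close>
  proof (cases "n z = 0")
    case True
    then have "\<And>v. v \<in> V \<Longrightarrow> z v = 0"
      using V by (simp add: n_def sum_nonneg_eq_0_iff)
    then show ?thesis using True by (simp add: q_def)
  next
    case False
    then have pos: "0 < n z" by (simp add: n_def sum_nonneg less_le)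
    define s where "s = sqrt (n z)"
    have s: "s > 0" "s\<^sup>2 = n z" using pos by (auto simp: s_def)
    define g where "g = (\<lambda>v. if v \<in> V then \<bar>z v\<bar> / s else 0)"
    have "n g = (\<Sum>v\<in>V. (z v)\<^sup>2 / s\<^sup>2)"
      unfolding n_def by (intro sum.cong) (auto simp: g_def power_divide)
    also have "\<dots> = 1" using s pos by (simp flip: sum_divide_distrib) (simp add: n_def)
    finally have ng: "n g = 1" .
    have "g v \<le> 1" if "v \<in> V" for v
    proof -
      have "(g v)\<^sup>2 \<le> n g"
        unfolding n_def by (rule member_le_sum) (use that V in auto)
      then show ?thesis using ng abs_le_square_iff[of "g v" 1] by simp
    qed
    then have "g \<in> K" using ng s by (auto simp: K_def) (auto simp: g_def)
    then have gf: "q g \<le> \<mu>" using f by (simp add: \<mu>_def)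
    have "q z \<le> (\<Sum>v\<in>V. \<Sum>w\<in>V. a v w * (\<bar>z v\<bar> * \<bar>z w\<bar>))"
      unfolding q_def
      by (intro sum_mono) (auto simp: mult.assoc nonneg abs_mult[symmetric] intro!: mult_left_mono)
    also have "\<dots> = (\<Sum>v\<in>V. \<Sum>w\<in>V. s\<^sup>2 * (a v w * g v * g w))"
      using s by (intro sum.cong refl) (auto simp: g_def power2_eq_square)
    also have "\<dots> = s\<^sup>2 * q g" by (simp add: q_def sum_distrib_left)
    also have "\<dots> \<le> s\<^sup>2 * \<mu>" using gf by (intro mult_left_mono) auto
    finally show ?thesis using s by (simp add: mult.commute)
  qed
  \<comment> \<open>\<open>f\<close> minimises the form \<open>\<mu> n - q \<ge> 0\<close>, so the linear term of this form in the direction \<open>e\<close> vanishes\<close>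
  have eig: "(\<Sum>w\<in>V. a v w * f w) = \<mu> * f v" if v: "v \<in> V" for v
  proof -
    define h where "h = (\<Sum>w\<in>V. a v w * f w)"
    define e where "e = (\<lambda>w. if w = v then 1 else 0 :: real)"
    have *: "(\<Sum>i\<in>V. g i * e i) = g v" for g :: "'a \<Rightarrow> real"
      using V v by (simp add: e_def if_distrib cong: if_cong)
    have n2: "n (\<lambda>w. f w + t * e w) = 1 + 2 * t * f v + t\<^sup>2" for t
    proof -
      have "n (\<lambda>w. f w + t * e w) = n f + 2 * t * (\<Sum>w\<in>V. f w * e w) + t\<^sup>2 * (\<Sum>w\<in>V. e w * e w)"
        by (simp add: n_def sum.distrib sum_distrib_left power2_eq_square algebra_simps)
      then show ?thesis by (simp only: * nf) (simp add: e_def)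
    qed
    have q2: "q (\<lambda>w. f w + t * e w) = \<mu> + 2 * t * h + t\<^sup>2 * a v v" for t
    proof -
      have "q (\<lambda>w. f w + t * e w) = q f + t * (\<Sum>i\<in>V. \<Sum>j\<in>V. a i j * f i * e j)
          + t * (\<Sum>i\<in>V. \<Sum>j\<in>V. a i j * e i * f j) + t\<^sup>2 * (\<Sum>i\<in>V. \<Sum>j\<in>V. a i j * e i * e j)"
        by (simp add: q_def sum.distrib sum_distrib_left power2_eq_square algebra_simps)
      moreover have "(\<Sum>i\<in>V. \<Sum>j\<in>V. a i j * f i * e j) = h"
        unfolding * h_def by (intro sum.cong) (auto simp: sym v)
      moreover have "(\<Sum>i\<in>V. \<Sum>j\<in>V. a i j * e i * f j) = h"
      proof -
        have "(\<Sum>i\<in>V. \<Sum>j\<in>V. a i j * e i * f j) = (\<Sum>i\<in>V. (\<Sum>j\<in>V. a i j * f j) * e i)"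
          by (simp add: sum_distrib_right sum_distrib_left mult_ac)
        then show ?thesis unfolding * h_def .
      qed
      moreover have "(\<Sum>i\<in>V. \<Sum>j\<in>V. a i j * e i * e j) = a v v"
        unfolding * by simp
      ultimately show ?thesis by (simp add: \<mu>_def)
    qed
    have "0 \<le> 2 * t * (\<mu> * f v - h) + t\<^sup>2 * (\<mu> - a v v)" for t
      using bound[of "\<lambda>w. f w + t * e w"] unfolding n2 q2 by (simp add: algebra_simps)
    from nonneg_quadratic_imp_linear_coeff_zero[OF this] show ?thesis by (simp add: h_def)
  qed
  have "\<exists>v\<in>V. f v \<noteq> 0"
  proof (rule ccontr)
    assume "\<not> (\<exists>v\<in>V. f v \<noteq> 0)"
    then have "n f = 0" by (simp add: n_def)
    with nf show False by simp
  qed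
  with that[of f \<mu>] f0 eig bound show ?thesis by (simp add: q_def n_def)
qed

section \<open>Counting with the Perron vector\<close>

text \<open>As \<open>E\<close> holds every edge in both directions, \<open>size\<close> amounts to
  m \<le> \<open>\<rho>\<^sup>2\<close>; book-freeness enters through
  \<open>codegree\<close>.\<close>

lemma complete_bipartite_if_small_codegrees:
  fixes E :: "('a \<times> 'a) set" and x :: "'a \<Rightarrow> real" and \<rho> :: real and r :: nat
  assumes V: "finite V" and EV: "E \<subseteq> V \<times> V" and sym: "sym E"
    and eig: "\<And>v. v \<in> V \<Longrightarrow> (\<Sum>w\<in>V. of_bool ((v, w) \<in> E) * x w) = \<rho> * x v"
    and x: "\<And>v. v \<in> V \<Longrightarrow> 0 < x v" "\<And>v. v \<in> V \<Longrightarrow> x v \<le> 1"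
    and u: "u \<in> V" "x u = 1"
    and codegree: "\<And>v w. (v, w) \<in> E \<Longrightarrow> card (E `` {v} \<inter> E `` {w}) \<le> r"
    and r: "r \<ge> 1" "8 * real r < \<rho>"
    and size: "real (card E) \<le> 2 * \<rho>\<^sup>2"
  shows "E = (E `` {u}) \<times> (V - E `` {u}) \<union> (V - E `` {u}) \<times> (E `` {u})"
proof -
  define A where "A = E `` {u}"
  define B where "B = V - A"
  define e where "e = (\<lambda>v w. of_bool ((v, w) \<in> E) :: real)"
  define d where "d = (\<lambda>X v. \<Sum>w\<in>X. e v w)"
  define s where "s = (\<lambda>X v. \<Sum>w\<in>X. e v w * x w)"
  \<comment> \<open>\<open>missing\<close> and \<open>M\<close> weigh the non-neighbours across the
    partition from its two sides. Both sums in \<open>miss_M\<close> therefore run over the same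
    non-adjacent pairs, with the product of the two entries as weight.\<close>
  define missing where "missing = (\<lambda>w. \<Sum>a\<in>A. (1 - e w a) * x a)"
  define M where "M = (\<lambda>a. \<Sum>w\<in>B. (1 - e a w) * x w)"
  define \<beta> where "\<beta> = sum x B"
  have AV: "A \<subseteq> V" and BV: "B \<subseteq> V" using EV by (auto simp: A_def B_def)
  have fin: "finite A" "finite B" using V AV BV finite_subset by auto
  have split: "sum g V = sum g A + sum g B" for g :: "'a \<Rightarrow> real"
    unfolding B_def using sum.subset_diff[OF AV V, of g] by simp
  have e01: "0 \<le> e v w" "e v w \<le> 1" for v w by (auto simp: e_def)
  have e_sym: "e v w = e w v" for v w using sym by (auto simp: e_def sym_def)
  have x0: "0 \<le> x v" if "v \<in> V" for v using x(1)[OF that] by simp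
  have eig': "s A v + s B v = \<rho> * x v" if "v \<in> V" for v
    using eig[OF that] by (simp add: s_def e_def split)
  have s_le_d: "s X v \<le> d X v" if "X \<subseteq> V" for X v
    unfolding s_def d_def using that x(2) e01 by (intro sum_mono) (auto intro!: mult_left_le)
  have s_nonneg: "0 \<le> s X v" if "X \<subseteq> V" for X v
    unfolding s_def using that x0 e01 by (intro sum_nonneg mult_nonneg_nonneg) auto
  have d_nonneg: "0 \<le> d X v" for X v
    unfolding d_def using e01 by (intro sum_nonneg) auto
  have sum_A: "sum x A = \<rho>"
  proof -
    have "s A u = sum x A" unfolding s_def by (intro sum.cong) (auto simp: e_def A_def)
    moreover have "s B u = 0" unfolding s_def by (intro sum.neutral) (auto simp: e_def B_def A_def)
    ultimately show ?thesis using eig'[OF u(1)] u(2) by simp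
  qed
  have swap: "(\<Sum>v\<in>X. \<Sum>w\<in>Y. e v w * g w) = (\<Sum>w\<in>Y. d X w * g w)" for X Y and g :: "'a \<Rightarrow> real"
    by (subst sum.swap) (simp add: d_def sum_distrib_right e_sym)
  \<comment> \<open>Applying the eigenvalue equation to every term of \<open>sum x A\<close>, itself
    equal to \<open>\<rho>\<close> by the equation at \<open>u\<close>, counts walks of length two
    from \<open>u\<close> weighted by their ends.\<close>
  have walks: "\<rho>\<^sup>2 = (\<Sum>a\<in>A. d A a * x a) + (\<Sum>w\<in>B. d A w * x w)"
  proof -
    have "\<rho>\<^sup>2 = (\<Sum>a\<in>A. \<rho> * x a)" by (simp add: power2_eq_square sum_A flip: sum_distrib_left)
    also have "\<dots> = (\<Sum>a\<in>A. s A a + s B a)" using AV eig' by (intro sum.cong) auto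
    also have "\<dots> = (\<Sum>a\<in>A. d A a * x a) + (\<Sum>w\<in>B. d A w * x w)"
      by (simp add: sum.distrib s_def swap)
    finally show ?thesis .
  qed
  have edges: "real (card E) = sum (d A) A + 2 * sum (d A) B + sum (d B) B"
  proof -
    have "real (card E) = (\<Sum>p\<in>V \<times> V. of_bool (p \<in> E))"
      using EV V by (simp add: Int_absorb1)
    also have "\<dots> = (\<Sum>v\<in>V. \<Sum>w\<in>V. e v w * 1)" by (simp add: sum.cartesian_product e_def)
    also have "\<dots> = sum (d V) V" unfolding swap by simp
    also have "\<dots> = sum (d A) A + sum (d B) A + (sum (d A) B + sum (d B) B)"
      by (simp add: split d_def sum.distrib)
    also have "sum (d B) A = sum (d A) B"
      using swap[where g = "\<lambda>_. 1" and X = A and Y = B] by (simp add: d_def)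
    finally show ?thesis by simp
  qed
  define R where "R = (\<Sum>a\<in>A. d A a * (2 * x a - 1))"
  have R: "sum (d B) B + 2 * (\<Sum>w\<in>B. d A w * (1 - x w)) \<le> R"
    using size unfolding edges walks R_def
    by (simp add: algebra_simps sum.distrib sum_subtractf sum_distrib_left)
  \<comment> \<open>The equation at \<open>w\<close> rewrites \<open>\<rho> - s A w\<close>. After
    multiplication by \<open>x w\<close>, the factor \<open>\<rho> * x w\<close> is at most the
    degree of \<open>w\<close>, and the two contributions of \<open>d B w\<close>, with factors
    \<open>1 - x w\<close> and \<open>x w\<close>, add up to one.\<close>
  have miss: "x w * missing w \<le> d A w * (1 - x w) + d B w" if w: "w \<in> B" for w
  proof -
    have wV: "w \<in> V" using w BV by blast
    have "missing w = \<rho> - s A w"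
      by (simp add: missing_def s_def algebra_simps sum_subtractf sum_A)
    then have "missing w = \<rho> * (1 - x w) + s B w"
      using eig'[OF wV] by (simp add: algebra_simps)
    also have "\<dots> \<le> \<rho> * (1 - x w) + d B w" using s_le_d[OF BV] by simp
    finally have "x w * missing w \<le> x w * (\<rho> * (1 - x w) + d B w)"
      using x0[OF wV] by (rule mult_left_mono)
    also have "\<dots> = (\<rho> * x w) * (1 - x w) + x w * d B w" by (simp add: algebra_simps)
    also have "(\<rho> * x w) * (1 - x w) \<le> (d A w + d B w) * (1 - x w)"
      using eig'[OF wV] s_le_d[OF AV, of w] s_le_d[OF BV, of w] x(2)[OF wV]
      by (intro mult_right_mono) auto
    finally show ?thesis by (simp add: algebra_simps)
  qed
  have missing_nonneg: "0 \<le> missing w" for w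
    unfolding missing_def using e01 x0 AV by (intro sum_nonneg mult_nonneg_nonneg) auto
  have M_nonneg: "0 \<le> M w" for w
    unfolding M_def using e01 x0 BV by (intro sum_nonneg mult_nonneg_nonneg) auto
  have excess_nonneg: "0 \<le> (\<Sum>w\<in>B. d A w * (1 - x w))"
    using d_nonneg x(2) BV by (intro sum_nonneg mult_nonneg_nonneg) auto
  have "(\<Sum>w\<in>B. x w * missing w) \<le> (\<Sum>w\<in>B. d A w * (1 - x w)) + sum (d B) B"
    unfolding sum.distrib[symmetric] by (intro sum_mono miss)
  then have miss_R: "(\<Sum>w\<in>B. x w * missing w) \<le> R" using R excess_nonneg by simp
  have miss_M: "(\<Sum>w\<in>B. x w * missing w) = (\<Sum>a\<in>A. x a * M a)"
    unfolding missing_def M_def sum_distrib_left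
    by (subst sum.swap) (intro sum.cong refl, simp add: e_sym mult_ac)
  have d_le_r: "d A v \<le> r" if "v \<in> A" for v
  proof -
    have "d A v = card (A \<inter> E `` {v})"
      using fin by (simp add: d_def e_def Image_singleton)
    then show ?thesis using codegree[of u v] that by (simp add: A_def)
  qed
  have key: "2 * r * (x a + x b - 1) < x a * M a + x b * M b"
    if ab: "a \<in> A" "b \<in> A" "(a, b) \<in> E" and le: "s B b \<le> s B a" for a b
  proof -
    have V': "a \<in> V" "b \<in> V" using ab AV by auto
    \<comment> \<open>The left-hand term exceeds \<open>x w\<close> only at a common neighbour, and
      there by \<open>x w \<le> 1\<close>; the total excess is thus at most a codegree.\<close>
    have "(\<Sum>w\<in>B. e a w * x w + e b w * x w) \<le> (\<Sum>w\<in>B. x w + e a w * e b w)"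
      using x(2) x0 BV by (intro sum_mono) (auto simp: e_def)
    then have "s B a + s B b \<le> \<beta> + (\<Sum>w\<in>B. e a w * e b w)"
      by (simp add: s_def \<beta>_def sum.distrib)
    also have "(\<Sum>w\<in>B. e a w * e b w) = card (B \<inter> (E `` {a} \<inter> E `` {b}))"
      using fin by (simp add: e_def Image_singleton Collect_conj_eq[symmetric] flip: of_bool_conj)
    also have "card (B \<inter> (E `` {a} \<inter> E `` {b})) \<le> card (E `` {a} \<inter> E `` {b})"
      using EV by (intro card_mono finite_subset[OF _ V]) auto
    also have "\<dots> \<le> r" using codegree ab by blast
    finally have overlap: "s B a + s B b \<le> \<beta> + r" by simp
    have M: "M v = \<beta> - s B v" for v
      by (simp add: M_def s_def \<beta>_def algebra_simps sum_subtractf)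
    show ?thesis
    proof (cases "x a + x b < 1")
      case True
      then have "2 * r * (x a + x b - 1) < 0" using r by (simp add: mult_less_0_iff)
      also have "0 \<le> x a * M a + x b * M b" using x0 V' M_nonneg by simp
      finally show ?thesis .
    next
      case False
      have "\<rho> \<le> \<rho> * (x a + x b)" using False r by simp
      also have "\<dots> \<le> 2 * r + s B a + s B b"
        using eig'[OF V'(1)] eig'[OF V'(2)] d_le_r[OF ab(1)] d_le_r[OF ab(2)]
          s_le_d[OF AV, of a] s_le_d[OF AV, of b]
        by (simp add: distrib_left)
      \<comment> \<open>The larger value \<open>s B a\<close> is at least
        \<open>(\<rho> - 2 * r) / 2 > 3 * r\<close>, and \<open>overlap\<close> gives
        \<open>M b \<ge> s B a - r\<close>. This is where the constant 8 comes from.\<close>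
      finally have "2 * r < M b" using overlap le r unfolding M by linarith
      then have "2 * r * x b < x b * M b" using x V' by (simp add: mult.commute)
      moreover have "2 * r * (x a + x b - 1) \<le> 2 * r * x b"
        using x(2)[OF V'(1)] by (intro mult_left_mono) auto
      moreover have "0 \<le> x a * M a" using x0 V' M_nonneg by simp
      ultimately show ?thesis by linarith
    qed
  qed
  have key': "2 * r * (x a + x b - 1) < x a * M a + x b * M b"
    if "a \<in> A" "b \<in> A" "(a, b) \<in> E" for a b
    using key[of a b] key[of b a] that sym by (cases "s B b \<le> s B a") (auto simp: sym_def add.commute)
  have double: "(\<Sum>a\<in>A. \<Sum>b\<in>A. e a b * (g a + g b)) = 2 * (\<Sum>a\<in>A. d A a * g a)"
    for g :: "'a \<Rightarrow> real"
    by (simp add: distrib_left sum.distrib swap) (simp add: d_def sum_distrib_right)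
  have A_indep: "(a, b) \<notin> E" if "a \<in> A" "b \<in> A" for a b
  proof
    assume ab: "(a, b) \<in> E"
    \<comment> \<open>\<open>F\<close> and \<open>H\<close> are the two sides of
      \<open>key'\<close>, set to 0 off the arcs, so the single arc \<open>(a, b)\<close> makes the
      summed inequality strict. By \<open>double\<close> and \<open>d_le_r\<close>, the sum of
      \<open>H\<close> is at most \<open>2 * r\<close> times the sum in \<open>miss_M\<close>, hence
      at most \<open>2 * r * R\<close>, which is the sum of \<open>F\<close>.\<close>
    define F where "F = (\<lambda>a b. e a b * (2 * r * (x a + x b - 1)))"
    define H where "H = (\<lambda>a b. e a b * (x a * M a + x b * M b))"
    have FH: "F a b \<le> H a b" if "a \<in> A" "b \<in> A" for a b
      using key'[OF that] by (cases "(a, b) \<in> E") (auto simp: F_def H_def e_def)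
    have "(\<Sum>a\<in>A. \<Sum>b\<in>A. F a b) < (\<Sum>a\<in>A. \<Sum>b\<in>A. H a b)"
    proof (rule sum_strict_mono_ex1[OF fin(1)])
      show "\<forall>a\<in>A. (\<Sum>b\<in>A. F a b) \<le> (\<Sum>b\<in>A. H a b)" using FH by (auto intro: sum_mono)
      have "F a b < H a b" using key'[OF that ab] ab by (simp add: F_def H_def e_def)
      then have "(\<Sum>b\<in>A. F a b) < (\<Sum>b\<in>A. H a b)"
        using FH that by (intro sum_strict_mono_ex1[OF fin(1)]) auto
      then show "\<exists>a\<in>A. (\<Sum>b\<in>A. F a b) < (\<Sum>b\<in>A. H a b)" using that by blast
    qed
    also have "(\<Sum>a\<in>A. \<Sum>b\<in>A. F a b) = 2 * r * R"
    proof -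
      have "(\<Sum>a\<in>A. \<Sum>b\<in>A. F a b) = (\<Sum>a\<in>A. \<Sum>b\<in>A. e a b * (r * (2 * x a - 1) + r * (2 * x b - 1)))"
        by (intro sum.cong) (auto simp: F_def algebra_simps)
      also have "\<dots> = 2 * r * R" unfolding double R_def sum_distrib_left
        by (intro sum.cong) (auto simp: algebra_simps)
      finally show ?thesis .
    qed
    also have "(\<Sum>a\<in>A. \<Sum>b\<in>A. H a b) = 2 * (\<Sum>a\<in>A. d A a * (x a * M a))"
      unfolding H_def double ..
    also have "\<dots> \<le> 2 * (\<Sum>a\<in>A. r * (x a * M a))"
      using d_le_r x0 AV M_nonneg by (intro mult_left_mono sum_mono mult_right_mono) auto
    also have "\<dots> = 2 * r * (\<Sum>a\<in>A. x a * M a)" by (simp add: sum_distrib_left mult_ac)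
    also have "\<dots> \<le> 2 * r * R" using miss_R miss_M by (intro mult_left_mono) auto
    finally show False by simp
  qed
  have "d A a = 0" if "a \<in> A" for a
    unfolding d_def using A_indep[OF that] by (intro sum.neutral) (auto simp: e_def)
  then have R0: "R = 0" by (simp add: R_def)
  have "sum (d B) B = 0" using R R0 excess_nonneg d_nonneg by (smt (verit) sum_nonneg)
  then have B_indep: "(v, w) \<notin> E" if "v \<in> B" "w \<in> B" for v w
    using that fin d_nonneg by (auto simp: sum_nonneg_eq_0_iff d_def e01) (auto simp: e_def)
  have "(\<Sum>w\<in>B. x w * missing w) = 0"
    using miss_R R0 missing_nonneg x0 BV by (intro antisym sum_nonneg) auto
  \<comment> \<open>Strict positivity of \<open>x\<close> turns the vanishing of a weighted sum into
    the vanishing of each term, here and again in \<open>joined\<close>.\<close>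
  then have no_missing: "missing w = 0" if "w \<in> B" for w
    using that fin x0 x(1) BV missing_nonneg by (subst (asm) sum_nonneg_eq_0_iff) force+
  have joined: "(w, a) \<in> E" if "w \<in> B" "a \<in> A" for w a
  proof -
    have "(1 - e w a) * x a = 0"
      using no_missing[OF that(1)] that fin e01 x0 AV
      unfolding missing_def by (subst (asm) sum_nonneg_eq_0_iff) auto
    then show ?thesis using x(1)[of a] AV that by (auto simp: e_def)
  qed
  have "E = A \<times> B \<union> B \<times> A"
  proof
    show "E \<subseteq> A \<times> B \<union> B \<times> A"
    proof (rule subrelI)
      fix v w assume vw: "(v, w) \<in> E"
      then have "v \<in> A \<or> v \<in> B" "w \<in> A \<or> w \<in> B" using EV by (auto simp: B_def)
      then show "(v, w) \<in> A \<times> B \<union> B \<times> A" using vw A_indep[of v w] B_indep[of v w] by auto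
    qed
    show "A \<times> B \<union> B \<times> A \<subseteq> E"
    proof (rule subrelI)
      fix v w assume "(v, w) \<in> A \<times> B \<union> B \<times> A"
      then show "(v, w) \<in> E" using joined[of v w] symD[OF sym joined[of w v]] by auto
    qed
  qed
  then show ?thesis by (simp add: A_def B_def)
qed

section \<open>Edge counts and books in graphs\<close>

text \<open>Forgetting orientation has fibres of size two: symmetry supplies the reversed arc, and
  the absence of loops makes it different.\<close>

lemma (in pair_graph) card_parcs_eq_twice_card_edges: "card (parcs G) = 2 * card (edges G)"
proof -
  define ends where "ends = (\<lambda>(u :: 'a, v). {u, v})"
  have edges_image: "edges G = ends ` parcs G" by (auto simp: edges_def ends_def)
  have "card {p \<in> parcs G. ends p = s} = 2" if s: "s \<in> ends ` parcs G" for s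
  proof -
    obtain u v where uv: "(u, v) \<in> parcs G" "s = {u, v}" using s by (auto simp: ends_def)
    have vu: "(v, u) \<in> parcs G" using uv pair_sym_arcs by (auto simp: symmetric_def sym_def)
    have "ends p = s \<longleftrightarrow> p = (u, v) \<or> p = (v, u)" for p
      by (cases p) (simp add: ends_def uv(2) doubleton_eq_iff)
    then have "{p \<in> parcs G. ends p = s} = {(u, v), (v, u)}" using uv(1) vu by blast
    moreover have "u \<noteq> v" using pair_no_loops[of "(u, v)"] uv by auto
    ultimately show ?thesis by simp
  qed
  then have "(\<Sum>s\<in>ends ` parcs G. card {p \<in> parcs G. ends p = s}) = (\<Sum>s\<in>ends ` parcs G. 2)"
    by (rule sum.cong[OF refl])
  moreover have "(\<Sum>s\<in>ends ` parcs G. card {p \<in> parcs G. ends p = s}) = card (parcs G)"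
    using sum.group[of "parcs G" "ends ` parcs G" ends "\<lambda>_. 1 :: nat"] pair_finite_arcs by simp
  ultimately show ?thesis by (simp add: edges_image)
qed

text \<open>The copy is the image of \<open>F\<close> under \<open>h\<close>. It need not be
  induced, so \<open>h\<close> only has to preserve arcs, not reflect them.\<close>

lemma contains_copy_if_inj:
  assumes "pair_wf_digraph G" "pair_wf_digraph F"
    and inj: "inj_on h (pverts F)"
    and verts: "h ` pverts F \<subseteq> pverts G"
    and arcs: "\<And>i j. (i, j) \<in> parcs F \<Longrightarrow> (h i, h j) \<in> parcs G"
  shows "contains_copy G F"
proof -
  interpret G: pair_wf_digraph G by fact
  interpret F: pair_wf_digraph F by fact
  define hom where "hom = \<lparr>iso_verts = h, iso_arcs = map_prod h h, iso_head = snd, iso_tail = fst\<rparr>"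
  have "inj_on (map_prod h h) (parcs F)"
    by (rule inj_on_subset[OF map_prod_inj_on[OF inj inj]]) (auto dest: F.wellformed')
  then have iso: "pre_digraph.digraph_isomorphism F hom"
    using inj F.wf_digraph_axioms
    by (auto simp: pre_digraph.digraph_isomorphism_def hom_def)
  then have wf: "wf_digraph (app_iso hom F)" by (rule F.wf_digraphI_app_iso)
  have "subgraph (app_iso hom F) G"
    using wf G.wf_digraph_axioms verts arcs
    by (auto simp: subgraph_def compatible_def hom_def)
  moreover have "digraph_iso F (app_iso hom F)" using iso by (auto simp: digraph_iso_def)
  ultimately show ?thesis by (auto simp: contains_copy_def)
qed

text \<open>An edge with \<open>k + 1\<close> common neighbours is the spine of a forbidden book
  whose pages end in these neighbours.\<close>

lemma (in pair_graph) codegree_le_if_book_free: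
  assumes free: "book_free (k + 1) G" and uv: "(u, v) \<in> parcs G"
  shows "card (parcs G `` {u} \<inter> parcs G `` {v}) \<le> k"
proof (rule ccontr)
  let ?C = "parcs G `` {u} \<inter> parcs G `` {v}"
  assume "\<not> card ?C \<le> k"
  then obtain T where T: "T \<subseteq> ?C" "card T = k + 1" "finite T"
    using obtain_subset_with_card_n[of "k + 1" ?C] by (metis Suc_eq_plus1 not_less_eq_eq)
  \<comment> \<open>In \<open>book (k + 1)\<close> the spine is 0 and 1, and
    \<open>{2..<k + 3}\<close> are the remaining \<open>k + 1\<close> vertices.\<close>
  then obtain g where g: "bij_betw g {2..<k + 3} T"
    using finite_same_card_bij[of "{2..<k + 3}" T] by auto
  have sym: "(y, x) \<in> parcs G" if "(x, y) \<in> parcs G" for x y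
    using that pair_sym_arcs by (auto simp: symmetric_def sym_def)
  have irrefl: "(x, x) \<notin> parcs G" for x using pair_no_loops[of "(x, x)"] by auto
  define h where "h = (\<lambda>i. if i = 0 then u else if i = 1 then v else g i)"
  have gC: "(u, g i) \<in> parcs G" "(v, g i) \<in> parcs G" if "2 \<le> i" "i < k + 3" for i
  proof -
    have "g i \<in> T" using bij_betw_apply[OF g, of i] that by simp
    then show "(u, g i) \<in> parcs G" "(v, g i) \<in> parcs G" using T(1) by auto
  qed
  then have nuv: "g i \<noteq> u" "g i \<noteq> v" if "2 \<le> i" "i < k + 3" for i
    using irrefl[of u] irrefl[of v] gC[OF that] by auto
  have h01: "h 0 = u" "h 1 = v" by (simp_all add: h_def)
  have "pair_wf_digraph (book (k + 1))"
    by unfold_locales (auto simp: book_def)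
  moreover have "inj_on h (pverts (book (k + 1)))"
  proof -
    have "inj_on h {2..<k + 3}"
      using bij_betw_imp_inj_on[OF g] by (auto simp: h_def inj_on_def)
    moreover have "u \<noteq> v" using uv irrefl by metis
    moreover have "pverts (book (k + 1)) = insert 0 (insert 1 {2..<k + 3})"
      by (auto simp: book_def)
    moreover have "h i \<noteq> u" "h i \<noteq> v" if "i \<in> {2..<k + 3}" for i
      using nuv[of i] that by (auto simp: h_def)
    then have "u \<notin> h ` {2..<k + 3}" "v \<notin> h ` {2..<k + 3}" by blast+
    ultimately show ?thesis using h01 by (simp add: inj_on_insert)
  qed
  moreover have "h ` pverts (book (k + 1)) \<subseteq> pverts G"
  proof (rule image_subsetI)
    fix i assume "i \<in> pverts (book (k + 1))"
    then show "h i \<in> pverts G"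
      using wellformed'[OF uv] in_arcsD2[OF gC(1)[of i]] by (auto simp: book_def h_def)
  qed
  moreover have "(h i, h j) \<in> parcs G" if "(i, j) \<in> parcs (book (k + 1))" for i j
  proof -
    have "{(u, h l), (h l, u), (v, h l), (h l, v)} \<subseteq> parcs G" if "l \<in> {2..<k + 3}" for l
      using gC[of l] sym[OF gC(1)[of l]] sym[OF gC(2)[of l]] that by (simp add: h_def)
    moreover have "(i, j) \<in> {(0, 1), (1, 0)} \<union>
        (\<Union>l\<in>{2..<k + 3}. {(0, l), (l, 0), (1, l), (l, 1)})"
      using that by (simp add: book_def numeral_3_eq_3)
    ultimately show ?thesis using uv sym[OF uv] h01 by blast
  qed
  ultimately have "contains_copy G (book (k + 1))"
    using contains_copy_if_inj pair_wf_digraph_axioms by blast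
  with free show False by (simp add: book_free_def)
qed

section \<open>Spectral radius and Perron vector\<close>

lemma (in pair_graph) Perron_vector:
  assumes conn: "Digraph_Component.connected (with_proj G)"
  obtains x where "\<And>v. v \<in> pverts G \<Longrightarrow> 0 < x v" "\<And>v. v \<in> pverts G \<Longrightarrow> x v \<le> 1"
    "\<exists>u\<in>pverts G. x u = 1"
    "\<And>v. v \<in> pverts G \<Longrightarrow>
      (\<Sum>w\<in>pverts G. of_bool ((v, w) \<in> parcs G) * x w) = graph_spectral_radius G * x v"
proof -
  define a where "a = (\<lambda>v w. of_bool ((v, w) \<in> parcs G) :: real)"
  have V: "finite (pverts G)" "pverts G \<noteq> {}"
    using pair_finite_verts conn by (auto simp: connected_conv)
  have sym: "(v, u) \<in> parcs G" if "(u, v) \<in> parcs G" for u v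
    using that pair_sym_arcs by (auto simp: symmetric_def sym_def)
  have "a v w = a w v" for v w using sym by (auto simp: a_def)
  moreover have "0 \<le> a v w" for v w by (simp add: a_def)
  ultimately obtain f \<mu> where f: "\<And>v. v \<in> pverts G \<Longrightarrow> 0 \<le> f v" "\<exists>v\<in>pverts G. f v \<noteq> 0"
    and eig: "\<And>v. v \<in> pverts G \<Longrightarrow> (\<Sum>w\<in>pverts G. a v w * f w) = \<mu> * f v"
    and max: "\<And>z. (\<Sum>v\<in>pverts G. \<Sum>w\<in>pverts G. a v w * z v * z w) \<le> \<mu> * (\<Sum>v\<in>pverts G. (z v)\<^sup>2)"
    using nonneg_symmetric_maximal_eigenvector[OF V, of a] by blast
  obtain vs where vs: "distinct vs" "set vs = pverts G"
    using finite_distinct_list[OF V(1)] by blast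
  let ?S = "spectrum (adjacency_matrix vs G)"
  have S: "k \<in> ?S \<longleftrightarrow> (\<exists>z. (\<exists>v\<in>pverts G. z v \<noteq> 0) \<and>
      (\<forall>v\<in>pverts G. (\<Sum>w\<in>pverts G. a v w * z w) = k * z v))" for k
    unfolding spectrum_def mem_Collect_eq eigenvalue_adjacency_matrix_iff[OF vs] a_def of_bool_def ..
  have "graph_spectral_radius G = \<mu>"
    unfolding graph_spectral_radius_eq[OF vs]
  proof (rule Max_eqI)
    show "finite ?S"
      using card_finite_spectrum(1)[of "adjacency_matrix vs G" "length vs"]
      by (simp add: adjacency_matrix_def)
    show "\<mu> \<in> ?S" unfolding S using f(2) eig by blast
    fix k assume "k \<in> ?S"
    then obtain z where z: "\<exists>v\<in>pverts G. z v \<noteq> 0"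
      "\<And>v. v \<in> pverts G \<Longrightarrow> (\<Sum>w\<in>pverts G. a v w * z w) = k * z v"
      unfolding S by blast
    \<comment> \<open>Testing the maximality of \<open>\<mu>\<close> on an eigenvector
      \<open>z\<close> for \<open>k\<close> compares the two eigenvalues directly.\<close>
    have "k * (\<Sum>v\<in>pverts G. (z v)\<^sup>2) = (\<Sum>v\<in>pverts G. z v * (k * z v))"
      by (simp add: sum_distrib_left power2_eq_square mult_ac)
    also have "\<dots> = (\<Sum>v\<in>pverts G. z v * (\<Sum>w\<in>pverts G. a v w * z w))"
      using z(2) by (intro sum.cong) auto
    also have "\<dots> = (\<Sum>v\<in>pverts G. \<Sum>w\<in>pverts G. a v w * z v * z w)"
      by (simp add: sum_distrib_left mult_ac)
    also have "\<dots> \<le> \<mu> * (\<Sum>v\<in>pverts G. (z v)\<^sup>2)" by (rule max)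
    finally have "k * (\<Sum>v\<in>pverts G. (z v)\<^sup>2) \<le> \<mu> * (\<Sum>v\<in>pverts G. (z v)\<^sup>2)" .
    moreover have "0 < (\<Sum>v\<in>pverts G. (z v)\<^sup>2)"
      using z(1) V by (auto intro: sum_pos2)
    ultimately show "k \<le> \<mu>" by simp
  qed
  \<comment> \<open>At a zero of \<open>f\<close> the eigenvalue equation is a vanishing sum of
    nonnegative terms, so zeros spread to neighbours and, by connectedness, to all vertices.\<close>
  have zero_step: "f w = 0" if "(v, w) \<in> parcs G" "f v = 0" for v w
  proof -
    have vw: "v \<in> pverts G" "w \<in> pverts G" using that wellformed' by auto
    have "(\<Sum>w\<in>pverts G. a v w * f w) = 0" using eig[OF vw(1)] that by simp
    then have "a v w * f w = 0"
      using V f vw by (subst (asm) sum_nonneg_eq_0_iff) (auto simp: a_def)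
    then show ?thesis using that by (simp add: a_def)
  qed
  have sc: "strongly_connected G"
    using symmetric_connected_imp_strongly_connected pair_sym_arcs conn by blast
  have pos: "0 < f v" if v: "v \<in> pverts G" for v
  proof (rule ccontr)
    assume "\<not> 0 < f v"
    then have "f v = 0" using f(1)[OF v] by simp
    moreover have "f w = 0" if "f v = 0" "v \<rightarrow>\<^sup>*\<^bsub>with_proj G\<^esub> w" for w
      using that(2,1) by (induction rule: reachable_induct) (auto intro: zero_step)
    ultimately show False using f(2) sc v by (auto simp: strongly_connected_def)
  qed
  define c where "c = Max (f ` pverts G)"
  have "c \<in> f ` pverts G" unfolding c_def using V by (intro Max_in) auto
  then obtain u where u: "u \<in> pverts G" "c = f u" by blast
  have c: "0 < c" using u pos by simp
  have c_max: "f v \<le> c" if "v \<in> pverts G" for v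
    unfolding c_def using V that by (intro Max_ge) auto
  show thesis
  proof (rule that[of "\<lambda>v. f v / c"])
    fix v assume v: "v \<in> pverts G"
    show "0 < f v / c" "f v / c \<le> 1" using pos c c_max v by auto
    have "(\<Sum>w\<in>pverts G. a v w * (f w / c)) = (\<Sum>w\<in>pverts G. a v w * f w) / c"
      by (simp add: sum_divide_distrib)
    then show "(\<Sum>w\<in>pverts G. of_bool ((v, w) \<in> parcs G) * (f w / c)) = graph_spectral_radius G * (f v / c)"
      using eig[OF v] \<open>graph_spectral_radius G = \<mu>\<close> by (simp add: a_def)
  next
    show "\<exists>u\<in>pverts G. f u / c = 1" using u c by auto
  qed
qed

section \<open>Complete bipartite graphs and the equality case\<close>

text \<open>Summing the equation over each side relates the two side sums linearly; eliminating one
  leaves the claim times \<open>sum x S\<close>, which positivity allows to cancel.\<close>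

lemma positive_eigenvalue_complete_bipartite:
  fixes x :: "'a \<Rightarrow> real"
  assumes fin: "finite S" "finite T" and ne: "S \<noteq> {}" and disj: "S \<inter> T = {}"
    and x: "\<And>v. v \<in> S \<union> T \<Longrightarrow> 0 < x v"
    and eig: "\<And>v. v \<in> S \<union> T \<Longrightarrow>
      (\<Sum>w\<in>S \<union> T. of_bool ((v, w) \<in> S \<times> T \<union> T \<times> S) * x w) = \<rho> * x v"
  shows "\<rho>\<^sup>2 = real (card S * card T)"
proof -
  have S: "\<rho> * x v = sum x T" if "v \<in> S" for v
  proof -
    have "\<rho> * x v = (\<Sum>w\<in>S \<union> T. if w \<in> T then x w else 0)"
      unfolding eig[OF UnI1[OF that], symmetric] using that disj by (intro sum.cong) auto
    then show ?thesis using fin by (simp add: sum.If_cases Int_absorb1)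
  qed
  have T: "\<rho> * x v = sum x S" if "v \<in> T" for v
  proof -
    have "\<rho> * x v = (\<Sum>w\<in>S \<union> T. if w \<in> S then x w else 0)"
      unfolding eig[OF UnI2[OF that], symmetric] using that disj by (intro sum.cong) auto
    then show ?thesis using fin by (simp add: sum.If_cases Int_absorb1)
  qed
  have "\<rho> * sum x S = card S * sum x T" using S by (simp add: sum_distrib_left)
  moreover have "\<rho> * sum x T = card T * sum x S" using T by (simp add: sum_distrib_left)
  ultimately have "\<rho>\<^sup>2 * sum x S = real (card S * card T) * sum x S"
    by (simp add: power2_eq_square mult_ac)
  moreover have "0 < sum x S" using fin ne x by (intro sum_pos) auto
  ultimately show ?thesis by simp
qed

theorem theorem1p3:
  fixes G :: "'a pair_pre_digraph" and r m :: nat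
  assumes "r \<ge> 1"
    and "pair_graph G"
    and "Digraph_Component.connected (with_proj G)"
    and "card (edges G) = m"
    and "m \<ge> (9 * r)^2"
    and "book_free (r + 1) G"
  shows "graph_spectral_radius G \<le> sqrt (real m) \<and>
    (graph_spectral_radius G = sqrt (real m) \<longleftrightarrow> complete_bipartite G)"
proof -
  interpret pair_graph G by fact
  let ?V = "pverts G" and ?E = "parcs G" and ?\<rho> = "graph_spectral_radius G"
  obtain x where x: "\<And>v. v \<in> ?V \<Longrightarrow> 0 < x v" "\<And>v. v \<in> ?V \<Longrightarrow> x v \<le> 1"
    and "\<exists>u\<in>?V. x u = 1"
    and eig: "\<And>v. v \<in> ?V \<Longrightarrow> (\<Sum>w\<in>?V. of_bool ((v, w) \<in> ?E) * x w) = ?\<rho> * x v"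
    using Perron_vector[OF assms(3)] by blast
  then obtain u where u: "u \<in> ?V" "x u = 1" by blast
  have arcs: "card ?E = 2 * m" using card_parcs_eq_twice_card_edges assms(4) by simp
  have m_pos: "0 < m" using assms(1,5) by (intro less_le_trans[OF _ assms(5)]) simp
  have \<rho>_nonneg: "0 \<le> ?\<rho>"
  proof -
    have "0 \<le> (\<Sum>w\<in>?V. of_bool ((u, w) \<in> ?E) * x w)"
      using x(1) by (intro sum_nonneg) (auto simp: less_imp_le)
    then show ?thesis using eig[OF u(1)] u(2) by simp
  qed
  \<comment> \<open>This implication also yields the bound: a radius above
    \<open>sqrt (real m)\<close> would make \<open>G\<close> complete bipartite, contradicting
    \<open>eq_if\<close>.\<close>
  have bipartite_if: "complete_bipartite G" if ge: "sqrt (real m) \<le> ?\<rho>"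
  proof -
    let ?A = "?E `` {u}"
    have "(9 * real r)\<^sup>2 \<le> real m"
      using assms(5) by (metis of_nat_le_iff of_nat_mult of_nat_numeral of_nat_power)
    \<comment> \<open>As \<open>r \<ge> 1\<close>, the constant 9 gives the strict inequality
      \<open>8 * real r < \<rho>\<close> required by the counting lemma.\<close>
    then have "9 * real r \<le> ?\<rho>" using ge real_le_rsqrt order_trans by blast
    moreover have "real m \<le> ?\<rho>\<^sup>2" using ge \<rho>_nonneg by (simp add: real_sqrt_le_iff sqrt_le_D)
    ultimately have E: "?E = ?A \<times> (?V - ?A) \<union> (?V - ?A) \<times> ?A"
      using assms(1) arcs pair_sym_arcs u x eig codegree_le_if_book_free[OF assms(6)]
      by (intro complete_bipartite_if_small_codegrees[where x = x and \<rho> = ?\<rho> and r = r])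
        (auto simp: pair_finite_verts symmetric_def dest: wellformed')
    have AV: "?A \<subseteq> ?V" by (auto dest: wellformed')
    have "?A \<noteq> {}"
    proof
      assume "?A = {}"
      then have "?E = {}" using E by simp
      then show False using arcs m_pos by simp
    qed
    moreover have "u \<notin> ?A" using pair_no_loops[of "(u, u)"] by auto
    ultimately have "1 \<le> card ?A" "1 \<le> card (?V - ?A)"
      using u(1) AV pair_finite_verts by (auto simp: Suc_le_eq card_gt_0_iff intro: finite_subset)
    moreover have "complete_bipartite_digraph (card ?A) (card (?V - ?A)) G"
    proof -
      have "?V = ?A \<union> (?V - ?A)" "?A \<inter> (?V - ?A) = {}" using AV by auto
      then show ?thesis
        unfolding complete_bipartite_digraph_pair_def using pair_finite_verts E by blast
    qed
    ultimately show ?thesis unfolding complete_bipartite_def by blast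
  qed
  have eq_if: "?\<rho> = sqrt (real m)" if cb: "complete_bipartite G"
  proof -
    obtain S T where ST: "card S \<ge> 1" "card T \<ge> 1" "?V = S \<union> T" "S \<inter> T = {}" "?E = S \<times> T \<union> T \<times> S"
      using cb unfolding complete_bipartite_def complete_bipartite_digraph_pair_def by blast
    then have fin: "finite S" "finite T" by (auto intro: card_ge_0_finite)
    have "card ?E = card (S \<times> T) + card (T \<times> S)"
      unfolding ST(5) using fin ST(4) by (intro card_Un_disjoint) auto
    then have "m = card S * card T" using arcs by (simp add: card_cartesian_product mult.commute)
    moreover have "?\<rho>\<^sup>2 = real (card S * card T)"
      using fin ST x eig by (intro positive_eigenvalue_complete_bipartite[where x = x and S = S and T = T]) auto
    ultimately show ?thesis using \<rho>_nonneg by (metis real_sqrt_unique)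
  qed
  show ?thesis using bipartite_if eq_if by fastforce
qed

end
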